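(* Let $T>R>P>S$ be real numbers with $2R>T+S$. Assume that X and Y, eventually, play Markov plans $\mathbf{p}$ and $\mathbf{q}$ respectively. If both plans are generous, then $\{cc\}$ is the only terminal set for the associated Markov chain on $\{cc,cd,dc,dd\}$. So from any initial play, with probability one, eventually the outcome sequence is constant at $cc$, and so $\lim_{N\to\infty}s^N=(R,R)$.
   Context: Iterated Prisoner's Dilemma. In each round $n=1,2,\dots$ players X and Y choose $c$ or $d$ (independently given the past). Outcomes are written with X's choice first; outcomes $cc,cd,dc,dd$ give the payoff pairs $S^n=(S^n_X,S^n_Y)=(R,R),(S,T),(T,S),(P,P)$ respectively, and $s^N=\frac1N\sum_{n=1}^N S^n$. A Markov plan for X is a vector $\mathbf{p}=(p_1,p_2,p_3,p_4)\in[0,1]^4$, where $p_1,p_2,p_3,p_4$ are the probabilities that X plays $c$ when the outcome of the previous round was $cc,cd,dc,dd$ respectively. A Markov plan $\mathbf{q}=(q_1,q_2,q_3,q_4)$ for Y is described from Y's perspective: Y plays $c$ with probability $q_1,q_3,q_2,q_4$ when the previous outcome (X's choice first) was $cc,cd,dc,dd$ respectively. When X uses $\mathbf{p}$ and Y uses $\mathbf{q}$, the outcomes follow a Markov chain whose transition probability from an outcome $z$ to an outcome is the product of the corresponding probabilities for the choices of X and Y. A player eventually plays a plan if the plan is used from some round $N^*$ on; play before that is arbitrary. A Markov plan $\mathbf{p}$ is generous when $p_1=1$, $0<p_2<1$ and $p_4>0$ (similarly for $\mathbf{q}$). For a finite Markov chain, a nonempty set $J$ of states is closed if no path of positive-probability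 transitions starting in $J$ leaves $J$; it is terminal if it is closed and, for all $i_1,i_2\in J$, there is a path of positive-probability transitions (with at least one step) from $i_1$ to $i_2$. *)

theory Defs
  imports "HOL-Probability.Probability"
begin

section \<open>Outcomes and payoffs\<close>

datatype move = Cooperate | Defect

text \<open>X's choice comes first.\<close>

type_synonym outcome = "move \<times> move"

abbreviation cc :: outcome where "cc \<equiv> (Cooperate, Cooperate)"
abbreviation cd :: outcome where "cd \<equiv> (Cooperate, Defect)"
abbreviation dc :: outcome where "dc \<equiv> (Defect, Cooperate)"
abbreviation dd :: outcome where "dd \<equiv> (Defect, Defect)"

fun payoff :: "real \<Rightarrow> real \<Rightarrow> real \<Rightarrow> real \<Rightarrow> outcome \<Rightarrow> real \<times> real" where
  "payoff T R P S (Cooperate, Cooperate) = (R, R)"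
| "payoff T R P S (Cooperate, Defect) = (S, T)"
| "payoff T R P S (Defect, Cooperate) = (T, S)"
| "payoff T R P S (Defect, Defect) = (P, P)"

definition avg_payoff ::
  "real \<Rightarrow> real \<Rightarrow> real \<Rightarrow> real \<Rightarrow> (nat \<Rightarrow> outcome) \<Rightarrow> nat \<Rightarrow> real \<times> real" where
  "avg_payoff T R P S z N = (1 / real N) *\<^sub>R (\<Sum>n=1..N. payoff T R P S (z n))"


section \<open>Markov plans and the associated chain\<close>

definition markov_plan :: "real ^ 4 \<Rightarrow> bool" where
  "markov_plan p \<longleftrightarrow> (\<forall>i. 0 \<le> p $ i \<and> p $ i \<le> 1)"

definition generous :: "real ^ 4 \<Rightarrow> bool" where
  "generous p \<longleftrightarrow> p $ 1 = 1 \<and> 0 < p $ 2 \<and> p $ 2 < 1 \<and> 0 < p $ 4"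

text \<open>
  \<open>coop_X p z\<close> and \<open>coop_Y q z\<close> are the probabilities of cooperating after outcome \<open>z\<close>.
  The vector \<open>q\<close> is written from Y's own perspective, so its components 2 and 3 are
  attached to \<open>dc\<close> and \<open>cd\<close>.
\<close>

fun coop_X :: "real ^ 4 \<Rightarrow> outcome \<Rightarrow> real" where
  "coop_X p (Cooperate, Cooperate) = p $ 1"
| "coop_X p (Cooperate, Defect) = p $ 2"
| "coop_X p (Defect, Cooperate) = p $ 3"
| "coop_X p (Defect, Defect) = p $ 4"

fun coop_Y :: "real ^ 4 \<Rightarrow> outcome \<Rightarrow> real" where
  "coop_Y q (Cooperate, Cooperate) = q $ 1"
| "coop_Y q (Cooperate, Defect) = q $ 3"
| "coop_Y q (Defect, Cooperate) = q $ 2"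
| "coop_Y q (Defect, Defect) = q $ 4"

fun move_prob :: "real \<Rightarrow> move \<Rightarrow> real" where
  "move_prob r Cooperate = r"
| "move_prob r Defect = 1 - r"

definition transition :: "real ^ 4 \<Rightarrow> real ^ 4 \<Rightarrow> outcome \<Rightarrow> outcome \<Rightarrow> real" where
  "transition p q z z' = move_prob (coop_X p z) (fst z') * move_prob (coop_Y q z) (snd z')"


section \<open>Closed and terminal sets\<close>

definition pos_steps :: "('s \<Rightarrow> 's \<Rightarrow> real) \<Rightarrow> ('s \<times> 's) set" where
  "pos_steps K = {(i, j). 0 < K i j}"

definition closed_set :: "('s \<Rightarrow> 's \<Rightarrow> real) \<Rightarrow> 's set \<Rightarrow> bool" where
  "closed_set K J \<longleftrightarrow> J \<noteq> {} \<and> (\<forall>i\<in>J. \<forall>j. (i, j) \<in> (pos_steps K)\<^sup>+ \<longrightarrow> j \<in> J)"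

definition terminal_set :: "('s \<Rightarrow> 's \<Rightarrow> real) \<Rightarrow> 's set \<Rightarrow> bool" where
  "terminal_set K J \<longleftrightarrow>
     closed_set K J \<and> (\<forall>i\<^sub>1\<in>J. \<forall>i\<^sub>2\<in>J. (i\<^sub>1, i\<^sub>2) \<in> (pos_steps K)\<^sup>+)"


section \<open>The repeated game as a stochastic process\<close>

text \<open>
  \<open>Z n\<close> is the random outcome of round \<open>n\<close> for \<open>n \<ge> 1\<close>; the value \<open>Z 0\<close> is never used.
  \<open>past Z n \<omega>\<close> lists the outcomes of rounds \<open>1, \<dots>, n - 1\<close>.
  All conditional probabilities below are taken only given histories of positive probability.
\<close>

definition past :: "(nat \<Rightarrow> 'a \<Rightarrow> outcome) \<Rightarrow> nat \<Rightarrow> 'a \<Rightarrow> outcome list" where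
  "past Z n \<omega> = map (\<lambda>k. Z k \<omega>) [1..<n]"

definition possible_past ::
  "'a measure \<Rightarrow> (nat \<Rightarrow> 'a \<Rightarrow> outcome) \<Rightarrow> nat \<Rightarrow> outcome list \<Rightarrow> bool" where
  "possible_past M Z n h \<longleftrightarrow> 0 < \<P>(\<omega> in M. past Z n \<omega> = h)"

text \<open>In every round the two choices are independent given the past.\<close>

definition game_play :: "'a measure \<Rightarrow> (nat \<Rightarrow> 'a \<Rightarrow> outcome) \<Rightarrow> bool" where
  "game_play M Z \<longleftrightarrow>
     prob_space M \<and>
     (\<forall>n\<ge>1. Z n \<in> measurable M (count_space UNIV)) \<and>
     (\<forall>n\<ge>1. \<forall>h a b. possible_past M Z n h \<longrightarrow>
        cond_prob M (\<lambda>\<omega>. Z n \<omega> = (a, b)) (\<lambda>\<omega>. past Z n \<omega> = h) =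
        cond_prob M (\<lambda>\<omega>. fst (Z n \<omega>) = a) (\<lambda>\<omega>. past Z n \<omega> = h) *
        cond_prob M (\<lambda>\<omega>. snd (Z n \<omega>) = b) (\<lambda>\<omega>. past Z n \<omega> = h))"

text \<open>
  A plan can be used only from round 2 on, since it responds to the previous outcome,
  which is the last entry of the history. Nothing is assumed about how a player chooses
  before round \<open>N\<^sub>0\<close>, and the two players may have different \<open>N\<^sub>0\<close>.
\<close>

definition X_eventually_plays ::
  "'a measure \<Rightarrow> (nat \<Rightarrow> 'a \<Rightarrow> outcome) \<Rightarrow> real ^ 4 \<Rightarrow> bool" where
  "X_eventually_plays M Z p \<longleftrightarrow>
     (\<exists>N\<^sub>0\<ge>2. \<forall>n\<ge>N\<^sub>0. \<forall>h. possible_past M Z n h \<longrightarrow>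
        cond_prob M (\<lambda>\<omega>. fst (Z n \<omega>) = Cooperate) (\<lambda>\<omega>. past Z n \<omega> = h) = coop_X p (last h))"

definition Y_eventually_plays ::
  "'a measure \<Rightarrow> (nat \<Rightarrow> 'a \<Rightarrow> outcome) \<Rightarrow> real ^ 4 \<Rightarrow> bool" where
  "Y_eventually_plays M Z q \<longleftrightarrow>
     (\<exists>N\<^sub>0\<ge>2. \<forall>n\<ge>N\<^sub>0. \<forall>h. possible_past M Z n h \<longrightarrow>
        cond_prob M (\<lambda>\<omega>. snd (Z n \<omega>) = Cooperate) (\<lambda>\<omega>. past Z n \<omega> = h) = coop_Y q (last h))"

end

theory Submission
  imports Defs
begin

text \<open>
  Against each other, two generous plans make \<open>cc\<close> an absorbing state of the associated chain,
  since both players answer \<open>cc\<close> with \<open>c\<close> for certain. It is also reachable from every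
  state. From \<open>dd\<close> both players cooperate at once with positive probability. From \<open>cd\<close> player X,
  who was just exploited, flips a genuinely random coin (\<open>0 < p\<^sub>2 < 1\<close>): if Y may cooperate
  after this outcome, X's coin can lead to \<open>cc\<close>, and if Y surely defects, X's coin can lead to \<open>dd\<close>
  and from there to \<open>cc\<close>. The case \<open>dc\<close> is the mirror image. An absorbing state reachable from
  everywhere is the only terminal set (\<open>terminal_set_iff_absorbing\<close>).

  For the random play, the distributions \<open>\<mu>\<^sub>n\<close> of the outcome of round \<open>n\<close> satisfy
  \<open>\<mu>\<^sub>n\<^sub>+\<^sub>1 = \<mu>\<^sub>n K\<close> from some round on (\<open>outcome_pair_prob\<close>, obtained by averaging over all
  pasts). The mass at \<open>cc\<close> then increases and stays below 1, so the amount flowing into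
  \<open>cc\<close> in one step tends to 0. Hence the mass at every state with a direct transition to \<open>cc\<close>
  tends to 0, and then so does the mass at every state with a transition to such a state, and
  so on along all paths that lead to \<open>cc\<close> (\<open>mass_vanishes_if_absorbed\<close>). Almost surely \<open>cc\<close>
  is never left once reached in late rounds, so the event that the play is not eventually \<open>cc\<close> is
  contained, up to a null set, in \<open>{Z n \<noteq> cc}\<close> for every late \<open>n\<close>, and is therefore null.
  The claim on average payoffs is then a statement about eventually constant sequences.
\<close>

section \<open>Absorbing states of finite chains\<close>

lemma terminal_set_iff_absorbing:
  assumes absorbing: "\<And>j. 0 < K a j \<longleftrightarrow> j = a"
    and reach: "\<And>i. (i, a) \<in> (pos_steps K)\<^sup>+"
  shows "terminal_set K J \<longleftrightarrow> J = {a}"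
proof -
  have stay: "j = a" if "(a, j) \<in> (pos_steps K)\<^sup>+" for j
    using that by (induction rule: trancl_induct) (auto simp: pos_steps_def absorbing)
  show ?thesis
  proof
    assume J: "terminal_set K J"
    then obtain i where "i \<in> J" by (auto simp: terminal_set_def closed_set_def)
    with J reach have "a \<in> J" unfolding terminal_set_def closed_set_def by blast
    with J stay show "J = {a}" unfolding terminal_set_def by blast
  next
    assume "J = {a}"
    then show "terminal_set K J"
      using reach stay by (auto simp: terminal_set_def closed_set_def)
  qed
qed

text \<open>
  From \<open>N\<close> on, the mass at \<open>a\<close> is a bounded increasing sequence, so its increments tend to 0; an increment
  contains \<open>\<mu>\<^sub>n(y) K(y, a)\<close> for every \<open>y \<noteq> a\<close>. This settles the states one step away from \<open>a\<close>.
  For longer paths, \<open>\<mu>\<^sub>n(y) K(y, z) \<le> \<mu>\<^sub>n\<^sub>+\<^sub>1(z)\<close> passes the claim from \<open>z\<close> to its predecessor \<open>y\<close>.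
\<close>

lemma mass_vanishes_if_absorbed:
  fixes K :: "'s::finite \<Rightarrow> 's \<Rightarrow> real" and \<mu> :: "nat \<Rightarrow> 's \<Rightarrow> real"
  assumes K_nonneg: "\<And>y z. 0 \<le> K y z"
    and absorbing: "K a a = 1"
    and nonneg: "\<And>n y. 0 \<le> \<mu> n y" and bounded: "\<And>n. \<mu> n a \<le> 1"
    and step: "\<And>n z. n \<ge> N \<Longrightarrow> \<mu> (Suc n) z = (\<Sum>y\<in>UNIV. \<mu> n y * K y z)"
    and path: "(y, a) \<in> (pos_steps K)\<^sup>+" and "y \<noteq> a"
  shows "(\<lambda>n. \<mu> n y) \<longlonglongrightarrow> 0"
proof -
  let ?inc = "\<lambda>n. \<mu> (Suc n) a - \<mu> n a"
  have inc_eq: "?inc n = (\<Sum>y\<in>UNIV-{a}. \<mu> n y * K y a)" if "n \<ge> N" for n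
    using step[OF that, of a] by (subst (asm) sum.remove[of UNIV a]) (simp_all add: absorbing)
  have "incseq (\<lambda>n. \<mu> (n + N) a)"
  proof (rule incseq_SucI)
    fix n
    have "0 \<le> ?inc (n + N)" by (subst inc_eq) (auto intro!: sum_nonneg mult_nonneg_nonneg nonneg K_nonneg)
    then show "\<mu> (n + N) a \<le> \<mu> (Suc n + N) a" by simp
  qed
  then obtain L where "(\<lambda>n. \<mu> (n + N) a) \<longlonglongrightarrow> L"
    by (rule incseq_convergent[where B = 1]) (use bounded in auto)
  then have L: "(\<lambda>n. \<mu> n a) \<longlonglongrightarrow> L" by (rule LIMSEQ_offset)
  have inc_lim: "?inc \<longlonglongrightarrow> 0" using tendsto_diff[OF LIMSEQ_Suc[OF L] L] by simp
  have squeeze: "(\<lambda>n. \<mu> n y) \<longlonglongrightarrow> 0"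
    if "0 < K y z" and f: "f \<longlonglongrightarrow> 0" and le: "\<And>n. n \<ge> N \<Longrightarrow> \<mu> n y * K y z \<le> f n" for y z f
  proof (rule tendsto_sandwich)
    show "eventually (\<lambda>n. 0 \<le> \<mu> n y) sequentially" by (simp add: nonneg)
    show "eventually (\<lambda>n. \<mu> n y \<le> f n / K y z) sequentially"
      using le \<open>0 < K y z\<close> by (intro eventually_sequentiallyI[of N]) (simp add: pos_le_divide_eq)
    show "(\<lambda>n. f n / K y z) \<longlonglongrightarrow> 0" using tendsto_divide[OF f tendsto_const[of "K y z"]] \<open>0 < K y z\<close> by simp
  qed simp
  have one_step: "(\<lambda>n. \<mu> n y) \<longlonglongrightarrow> 0" if "0 < K y a" "y \<noteq> a" for y
  proof (rule squeeze[OF that(1) inc_lim])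
    fix n assume "n \<ge> N"
    then show "\<mu> n y * K y a \<le> ?inc n"
      unfolding inc_eq[OF \<open>n \<ge> N\<close>]
      using that by (intro member_le_sum) (auto intro!: mult_nonneg_nonneg nonneg K_nonneg)
  qed
  from path have "y \<noteq> a \<longrightarrow> (\<lambda>n. \<mu> n y) \<longlonglongrightarrow> 0"
  proof (induction rule: converse_trancl_induct)
    case (base y)
    then show ?case using one_step by (simp add: pos_steps_def)
  next
    case (step y z)
    then have pos: "0 < K y z" by (simp add: pos_steps_def)
    show ?case
    proof (cases "z = a")
      case True
      then show ?thesis using one_step pos by blast
    next
      case False
      then have "(\<lambda>n. \<mu> (Suc n) z) \<longlonglongrightarrow> 0" using step.IH LIMSEQ_Suc by blast
      moreover have "\<mu> n y * K y z \<le> \<mu> (Suc n) z" if "n \<ge> N" for n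
        unfolding assms(5)[OF that]
        by (intro member_le_sum) (auto intro!: mult_nonneg_nonneg nonneg K_nonneg)
      ultimately show ?thesis using squeeze[OF pos] by blast
    qed
  qed
  with \<open>y \<noteq> a\<close> show ?thesis by simp
qed

section \<open>The chain of two generous plans\<close>

instance move :: finite
proof
  have "(UNIV :: move set) = {Cooperate, Defect}" using move.exhaust by auto
  then show "finite (UNIV :: move set)" by (metis finite.emptyI finite.insertI)
qed

lemma outcome_cases:
  fixes z :: outcome
  obtains "z = cc" | "z = cd" | "z = dc" | "z = dd"
  by (cases z, cases "fst z"; cases "snd z") auto

lemma coop_prob_bounds:
  assumes "markov_plan r"
  shows "0 \<le> coop_X r z" "coop_X r z \<le> 1" "0 \<le> coop_Y r z" "coop_Y r z \<le> 1"
  using assms by (cases z rule: outcome_cases; simp add: markov_plan_def)+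

lemma transition_nonneg:
  assumes "markov_plan p" "markov_plan q"
  shows "0 \<le> transition p q z z'"
proof -
  have "0 \<le> move_prob r m" if "0 \<le> r" "r \<le> 1" for r m using that by (cases m) auto
  then show ?thesis unfolding transition_def by (simp add: coop_prob_bounds assms)
qed

lemma transition_cc:
  assumes "generous p" "generous q"
  shows "transition p q cc z = (if z = cc then 1 else 0)"
  using assms by (cases z rule: outcome_cases) (auto simp: generous_def transition_def)

text \<open>
  After \<open>cd\<close>, one of the two ways to \<open>cc\<close> is open whatever \<open>q\<^sub>3\<close> is: directly if \<open>q\<^sub>3 > 0\<close>, and
  through \<open>dd\<close> if \<open>q\<^sub>3 = 0\<close>, where \<open>p\<^sub>2 < 1\<close> is what lets X defect. After \<open>dc\<close> the same holds with
  the players exchanged.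
\<close>

lemma cc_reachable:
  assumes "markov_plan p" "markov_plan q" "generous p" "generous q"
  shows "(z, cc) \<in> (pos_steps (transition p q))\<^sup>+"
proof -
  let ?E = "pos_steps (transition p q)"
  have bounds: "0 \<le> p $ 3" "0 \<le> q $ 3" using assms by (auto simp: markov_plan_def)
  have gen: "0 < p $ 2" "p $ 2 < 1" "0 < p $ 4" "0 < q $ 2" "q $ 2 < 1" "0 < q $ 4"
    "p $ 1 = 1" "q $ 1 = 1"
    using assms by (auto simp: generous_def)
  have dd: "(dd, cc) \<in> ?E" using gen by (simp add: pos_steps_def transition_def)
  have cd: "(cd, cc) \<in> ?E \<or> (cd, dd) \<in> ?E"
    using gen bounds by (cases "q $ 3 = 0") (auto simp: pos_steps_def transition_def)
  have dc: "(dc, cc) \<in> ?E \<or> (dc, dd) \<in> ?E"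
    using gen bounds by (cases "p $ 3 = 0") (auto simp: pos_steps_def transition_def)
  have cc: "(cc, cc) \<in> ?E" using gen by (simp add: pos_steps_def transition_def)
  have via_dd: "(z, cc) \<in> ?E\<^sup>+" if "(z, cc) \<in> ?E \<or> (z, dd) \<in> ?E" for z
    using that r_into_trancl trancl_into_trancl2[OF _ r_into_trancl[OF dd]] by metis
  show ?thesis
    by (rule outcome_cases[of z]) (use cc cd dc dd via_dd in simp_all)
qed

section \<open>Distribution of successive outcomes\<close>

lemma past_Suc: "n \<ge> 1 \<Longrightarrow> past Z (Suc n) \<omega> = past Z n \<omega> @ [Z n \<omega>]"
  by (simp add: past_def)

lemma last_past: "n \<ge> 1 \<Longrightarrow> last (past Z (Suc n) \<omega>) = Z n \<omega>"
  by (simp add: past_Suc)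

lemma length_past: "length (past Z n \<omega>) = n - 1"
  by (simp add: past_def)

lemma measurable_past:
  assumes "\<And>k. k \<ge> 1 \<Longrightarrow> Z k \<in> measurable M (count_space UNIV)"
  shows "past Z n \<in> measurable M (count_space UNIV)"
proof (induction n)
  case 0
  have "past Z 0 = (\<lambda>_. [])" by (auto simp: past_def)
  then show ?case by simp
next
  case (Suc n)
  show ?case
  proof (cases "n \<ge> 1")
    case True
    note [measurable] = Suc.IH assms[OF True]
    have "past Z (Suc n) = (\<lambda>\<omega>. past Z n \<omega> @ [Z n \<omega>])"
      by (rule ext) (rule past_Suc[OF True])
    then show ?thesis by simp
  next
    case False
    then have "past Z (Suc n) = (\<lambda>_. [])" by (auto simp: past_def)
    then show ?thesis by simp
  qed
qed

text \<open>
  Independence of the two choices given the past makes the conditional law of the next outcome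
  the corresponding row of the transition matrix. Pasts of probability 0, on which nothing is
  known about the play, contribute 0 to both sides.
\<close>

lemma past_and_outcome_prob:
  assumes game: "game_play M Z" and n: "n \<ge> 1"
    and X: "possible_past M Z n h \<Longrightarrow>
      cond_prob M (\<lambda>\<omega>. fst (Z n \<omega>) = Cooperate) (\<lambda>\<omega>. past Z n \<omega> = h) = coop_X p (last h)"
    and Y: "possible_past M Z n h \<Longrightarrow>
      cond_prob M (\<lambda>\<omega>. snd (Z n \<omega>) = Cooperate) (\<lambda>\<omega>. past Z n \<omega> = h) = coop_Y q (last h)"
  shows "\<P>(\<omega> in M. Z n \<omega> = z \<and> past Z n \<omega> = h) =
         \<P>(\<omega> in M. past Z n \<omega> = h) * transition p q (last h) z"
proof -
  interpret prob_space M using game by (simp add: game_play_def)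
  have Z: "\<And>k. k \<ge> 1 \<Longrightarrow> Z k \<in> measurable M (count_space UNIV)"
    using game by (simp add: game_play_def)
  note [measurable] = Z[OF n] measurable_past[OF Z]
  show ?thesis
  proof (cases "possible_past M Z n h")
    case False
    then have 0: "\<P>(\<omega> in M. past Z n \<omega> = h) = 0"
      unfolding possible_past_def by (simp add: less_le)
    have "\<P>(\<omega> in M. Z n \<omega> = z \<and> past Z n \<omega> = h) \<le> \<P>(\<omega> in M. past Z n \<omega> = h)"
      by (intro finite_measure_mono) auto
    with 0 show ?thesis by (simp add: measure_le_0_iff)
  next
    case True
    let ?c = "\<lambda>Q. cond_prob M Q (\<lambda>\<omega>. past Z n \<omega> = h)"
    have pos: "0 < \<P>(\<omega> in M. past Z n \<omega> = h)" using True by (simp add: possible_past_def)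
    \<comment> \<open>The plans prescribe the probabilities of cooperating; those of defecting are the complements.\<close>
    have move: "?c (\<lambda>\<omega>. f (Z n \<omega>) = m) = move_prob (?c (\<lambda>\<omega>. f (Z n \<omega>) = Cooperate)) m"
      for f :: "outcome \<Rightarrow> move" and m
    proof (cases m)
      case Defect
      have "\<P>(\<omega> in M. past Z n \<omega> = h) =
          \<P>(\<omega> in M. f (Z n \<omega>) = Cooperate \<and> past Z n \<omega> = h) +
          \<P>(\<omega> in M. f (Z n \<omega>) = Defect \<and> past Z n \<omega> = h)"
        by (subst finite_measure_Union[symmetric]) (auto intro!: arg_cong[where f = prob] intro: move.exhaust)
      with pos show ?thesis by (simp add: Defect cond_prob_def field_simps)
    qed simp
    have "?c (\<lambda>\<omega>. Z n \<omega> = (fst z, snd z)) =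
        ?c (\<lambda>\<omega>. fst (Z n \<omega>) = fst z) * ?c (\<lambda>\<omega>. snd (Z n \<omega>) = snd z)"
      using game n True unfolding game_play_def by blast
    also have "\<dots> = transition p q (last h) z"
      unfolding move[of fst "fst z"] move[of snd "snd z"] X[OF True] Y[OF True] transition_def ..
    finally show ?thesis using pos by (simp add: cond_prob_def field_simps)
  qed
qed

text \<open>
  Although plans are conditioned on the whole past, only its last entry matters, so summing over
  the finitely many pasts with last entry \<open>y\<close> leaves the one-step Markov property.
\<close>

lemma outcome_pair_prob:
  assumes game: "game_play M Z" and n: "n \<ge> 1"
    and X: "\<And>h. possible_past M Z (Suc n) h \<Longrightarrow>
      cond_prob M (\<lambda>\<omega>. fst (Z (Suc n) \<omega>) = Cooperate) (\<lambda>\<omega>. past Z (Suc n) \<omega> = h) = coop_X p (last h)"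
    and Y: "\<And>h. possible_past M Z (Suc n) h \<Longrightarrow>
      cond_prob M (\<lambda>\<omega>. snd (Z (Suc n) \<omega>) = Cooperate) (\<lambda>\<omega>. past Z (Suc n) \<omega> = h) = coop_Y q (last h)"
  shows "\<P>(\<omega> in M. Z n \<omega> = y \<and> Z (Suc n) \<omega> = z) = \<P>(\<omega> in M. Z n \<omega> = y) * transition p q y z"
proof -
  interpret prob_space M using game by (simp add: game_play_def)
  have Z: "\<And>k. k \<ge> 1 \<Longrightarrow> Z k \<in> measurable M (count_space UNIV)"
    using game by (simp add: game_play_def)
  note [measurable] = Z[OF n] Z[of "Suc n", simplified] measurable_past[OF Z]
  define H where "H = {h :: outcome list. set h \<subseteq> UNIV \<and> length h = n} \<inter> {h. last h = y}"
  have fin: "finite H" unfolding H_def by (intro finite_Int disjI1 finite_lists_length_eq) simp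
  have in_H: "past Z (Suc n) \<omega> \<in> H \<longleftrightarrow> Z n \<omega> = y" for \<omega>
    by (simp add: H_def length_past last_past[OF n])
  have "\<P>(\<omega> in M. Z n \<omega> = y \<and> Z (Suc n) \<omega> = z) =
      (\<Sum>h\<in>H. \<P>(\<omega> in M. Z (Suc n) \<omega> = z \<and> past Z (Suc n) \<omega> = h))"
    by (rule prob_sum[OF fin]) (auto simp flip: in_H)
  also have "\<dots> = (\<Sum>h\<in>H. \<P>(\<omega> in M. past Z (Suc n) \<omega> = h) * transition p q y z)"
    by (intro sum.cong refl, subst past_and_outcome_prob[OF game _ X Y]) (auto simp: H_def)
  also have "\<dots> = (\<Sum>h\<in>H. \<P>(\<omega> in M. past Z (Suc n) \<omega> = h)) * transition p q y z"
    by (simp add: sum_distrib_right)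
  also have "(\<Sum>h\<in>H. \<P>(\<omega> in M. past Z (Suc n) \<omega> = h)) = \<P>(\<omega> in M. Z n \<omega> = y)"
    by (rule prob_sum[OF fin, symmetric]) (auto simp flip: in_H)
  finally show ?thesis .
qed

text \<open>
  Because \<open>cc\<close> is almost surely never left in late rounds, not settling at \<open>cc\<close> means avoiding
  it in every late round, which is at most as likely as avoiding it in a single one. Convergence
  of the one-round distributions is therefore enough, with no independence and no estimate of
  absorption times.
\<close>

lemma AE_eventually_cc:
  assumes plans: "markov_plan p" "markov_plan q" "generous p" "generous q"
    and game: "game_play M Z"
    and X: "X_eventually_plays M Z p" and Y: "Y_eventually_plays M Z q"
  shows "AE \<omega> in M. \<exists>n\<^sub>0. \<forall>n\<ge>n\<^sub>0. Z n \<omega> = cc"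
proof -
  interpret prob_space M using game by (simp add: game_play_def)
  have Z: "\<And>k. k \<ge> 1 \<Longrightarrow> Z k \<in> measurable M (count_space UNIV)"
    using game by (simp add: game_play_def)
  obtain N\<^sub>X where N\<^sub>X: "\<And>n h. n \<ge> N\<^sub>X \<Longrightarrow> possible_past M Z n h \<Longrightarrow>
      cond_prob M (\<lambda>\<omega>. fst (Z n \<omega>) = Cooperate) (\<lambda>\<omega>. past Z n \<omega> = h) = coop_X p (last h)"
    using X unfolding X_eventually_plays_def by blast
  obtain N\<^sub>Y where N\<^sub>Y: "\<And>n h. n \<ge> N\<^sub>Y \<Longrightarrow> possible_past M Z n h \<Longrightarrow>
      cond_prob M (\<lambda>\<omega>. snd (Z n \<omega>) = Cooperate) (\<lambda>\<omega>. past Z n \<omega> = h) = coop_Y q (last h)"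
    using Y unfolding Y_eventually_plays_def by blast
  define N where "N = Max {1, N\<^sub>X, N\<^sub>Y}"
  have N: "N \<ge> 1" "N \<ge> N\<^sub>X" "N \<ge> N\<^sub>Y" by (auto simp: N_def)
  \<comment> \<open>Since \<open>N \<ge> 1\<close>, the unconstrained \<open>Z 0\<close>, which need not be measurable, stays out of play.\<close>
  have pair: "\<P>(\<omega> in M. Z n \<omega> = y \<and> Z (Suc n) \<omega> = z) = \<P>(\<omega> in M. Z n \<omega> = y) * transition p q y z"
    if "n \<ge> N" for n y z
    using that N by (intro outcome_pair_prob[OF game] N\<^sub>X N\<^sub>Y) auto
  define \<mu> where "\<mu> n y = \<P>(\<omega> in M. Z n \<omega> = y)" for n y
  have step: "\<mu> (Suc n) z = (\<Sum>y\<in>UNIV. \<mu> n y * transition p q y z)" if "n \<ge> N" for n z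
  proof -
    have [measurable]: "Z n \<in> measurable M (count_space UNIV)" using Z that N by auto
    have [measurable]: "Z (Suc n) \<in> measurable M (count_space UNIV)" using Z by auto
    have "\<mu> (Suc n) z = (\<Sum>y\<in>UNIV. \<P>(\<omega> in M. Z n \<omega> = y \<and> Z (Suc n) \<omega> = z))"
      unfolding \<mu>_def by (rule prob_sum) auto
    then show ?thesis by (simp add: pair[OF that] \<mu>_def)
  qed
  have vanish: "(\<lambda>n. \<mu> n y) \<longlonglongrightarrow> 0" if "y \<noteq> cc" for y
    using that plans step
    by (intro mass_vanishes_if_absorbed[where K = "transition p q" and a = cc and N = N])
      (auto simp: transition_nonneg transition_cc cc_reachable \<mu>_def)
  have not_cc: "\<P>(\<omega> in M. Z n \<omega> \<noteq> cc) = (\<Sum>y\<in>UNIV-{cc}. \<mu> n y)" if "n \<ge> N" for n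
  proof -
    have [measurable]: "Z n \<in> measurable M (count_space UNIV)" using Z that N by auto
    show ?thesis unfolding \<mu>_def by (rule prob_sum) auto
  qed
  have "(\<lambda>n. \<Sum>y\<in>UNIV-{cc}. \<mu> n y) \<longlonglongrightarrow> 0"
    using tendsto_sum[of "UNIV-{cc}" "\<lambda>y n. \<mu> n y" "\<lambda>_. 0"] vanish by simp
  then have lim: "(\<lambda>n. \<P>(\<omega> in M. Z n \<omega> \<noteq> cc)) \<longlonglongrightarrow> 0"
    by (rule Lim_transform_eventually) (auto intro!: eventually_sequentiallyI[of N] simp: not_cc)
  have stay: "AE \<omega> in M. \<forall>n\<ge>N. Z n \<omega> = cc \<longrightarrow> Z (Suc n) \<omega> = cc"
    unfolding AE_all_countable
  proof (intro allI)
    fix n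
    show "AE \<omega> in M. n \<ge> N \<longrightarrow> Z n \<omega> = cc \<longrightarrow> Z (Suc n) \<omega> = cc"
    proof (cases "n \<ge> N")
      case True
      have [measurable]: "Z n \<in> measurable M (count_space UNIV)" using Z True N by auto
      have [measurable]: "Z (Suc n) \<in> measurable M (count_space UNIV)" using Z by auto
      have "AE \<omega> in M. \<not> (Z n \<omega> = cc \<and> Z (Suc n) \<omega> = z)" if "z \<noteq> cc" for z
      proof -
        have "\<P>(\<omega> in M. Z n \<omega> = cc \<and> Z (Suc n) \<omega> = z) = 0"
          using that plans by (simp add: pair[OF True] transition_cc)
        then show ?thesis by (subst (asm) prob_Collect_eq_0) auto
      qed
      then have "AE \<omega> in M. \<forall>z. z \<noteq> cc \<longrightarrow> \<not> (Z n \<omega> = cc \<and> Z (Suc n) \<omega> = z)"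
        unfolding AE_all_countable by auto
      then show ?thesis
      proof eventually_elim
        case (elim \<omega>)
        from elim[rule_format, of "Z (Suc n) \<omega>"] show ?case by blast
      qed
    qed simp
  qed
  have "AE \<omega> in M. \<not> (\<forall>n\<ge>N. Z n \<omega> \<noteq> cc)"
  proof -
    have ev: "{\<omega>\<in>space M. \<forall>n\<ge>N. Z n \<omega> \<noteq> cc} \<in> events"
    proof -
      have "{\<omega>\<in>space M. Z n \<omega> \<noteq> cc} \<in> events" if "n \<ge> N" for n
      proof -
        have [measurable]: "Z n \<in> measurable M (count_space UNIV)" using Z that N by auto
        show ?thesis by measurable
      qed
      then have "{\<omega>\<in>space M. n \<ge> N \<longrightarrow> Z n \<omega> \<noteq> cc} \<in> events" for n
        by (cases "n \<ge> N") auto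
      then show ?thesis by (rule sets.sets_Collect_countable_All)
    qed
    have "\<P>(\<omega> in M. \<forall>n\<ge>N. Z n \<omega> \<noteq> cc) \<le> 0"
    proof (rule LIMSEQ_le_const[OF lim], intro exI allI impI)
      fix n assume "n \<ge> N"
      then have [measurable]: "Z n \<in> measurable M (count_space UNIV)" using Z N by auto
      show "\<P>(\<omega> in M. \<forall>n\<ge>N. Z n \<omega> \<noteq> cc) \<le> \<P>(\<omega> in M. Z n \<omega> \<noteq> cc)"
        using \<open>n \<ge> N\<close> by (intro finite_measure_mono) auto
    qed
    then have "\<P>(\<omega> in M. \<forall>n\<ge>N. Z n \<omega> \<noteq> cc) = 0" by (simp add: measure_le_0_iff)
    then show ?thesis by (rule iffD1[OF prob_Collect_eq_0[OF ev]])
  qed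
  with stay show ?thesis
  proof eventually_elim
    case (elim \<omega>)
    then obtain m where m: "m \<ge> N" "Z m \<omega> = cc" by blast
    have "Z n \<omega> = cc" if "n \<ge> m" for n
      using that
    proof (induction n rule: dec_induct)
      case base
      show ?case by (fact m(2))
    next
      case (step n)
      then show ?case using elim(1) m(1) le_trans by blast
    qed
    then show ?case by blast
  qed
qed

section \<open>Average payoffs\<close>

text \<open>
  The deviations of the terms from \<open>c\<close> have a fixed sum \<open>D\<close> from some index on, so the average
  differs from \<open>c\<close> by \<open>D / N\<close>.
\<close>

lemma averages_of_eventually_constant:
  fixes f :: "nat \<Rightarrow> 'a::real_normed_vector"
  assumes "\<And>n. n \<ge> m \<Longrightarrow> f n = c"
  shows "(\<lambda>N. (1 / real N) *\<^sub>R (\<Sum>n=1..N. f n)) \<longlonglongrightarrow> c"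
proof -
  define D where "D = (\<Sum>n=1..m. f n - c)"
  have "(\<lambda>N. (1 / real N) *\<^sub>R D + c) \<longlonglongrightarrow> 0 *\<^sub>R D + c"
    by (intro tendsto_intros lim_1_over_n)
  then have "(\<lambda>N. (1 / real N) *\<^sub>R D + c) \<longlonglongrightarrow> c" by simp
  then show ?thesis
  proof (rule Lim_transform_eventually)
    have "(1 / real N) *\<^sub>R D + c = (1 / real N) *\<^sub>R (\<Sum>n=1..N. f n)" if "N \<ge> Suc m" for N
    proof -
      have "D = (\<Sum>n=1..N. f n - c)"
        unfolding D_def using that by (intro sum.mono_neutral_left) (auto simp: assms)
      also have "\<dots> = (\<Sum>n=1..N. f n) - real N *\<^sub>R c"
        by (simp add: sum_subtractf sum_constant_scaleR)
      finally show ?thesis using that by (simp add: scaleR_diff_right)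
    qed
    then show "eventually (\<lambda>N. (1 / real N) *\<^sub>R D + c = (1 / real N) *\<^sub>R (\<Sum>n=1..N. f n)) sequentially"
      by (rule eventually_sequentiallyI)
  qed
qed

theorem theorem3p4:
  fixes T R P S :: real
    and p q :: "real ^ 4"
    and M :: "'a measure"
    and Z :: "nat \<Rightarrow> 'a \<Rightarrow> outcome"
  assumes "T > R" and "R > P" and "P > S" and "2 * R > T + S"
    and "markov_plan p" and "markov_plan q"
    and "game_play M Z"
    and "X_eventually_plays M Z p" and "Y_eventually_plays M Z q"
    and "generous p" and "generous q"
  shows "(\<forall>J. terminal_set (transition p q) J \<longleftrightarrow> J = {cc}) \<and>
         (AE \<omega> in M. (\<exists>n\<^sub>0. \<forall>n\<ge>n\<^sub>0. Z n \<omega> = cc)) \<and>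
         (AE \<omega> in M. (\<lambda>N. avg_payoff T R P S (\<lambda>n. Z n \<omega>) N) \<longlonglongrightarrow> (R, R))"
proof (intro conjI allI)
  show "terminal_set (transition p q) J \<longleftrightarrow> J = {cc}" for J
    using assms by (intro terminal_set_iff_absorbing) (auto simp: transition_cc cc_reachable)
  show ev: "AE \<omega> in M. \<exists>n\<^sub>0. \<forall>n\<ge>n\<^sub>0. Z n \<omega> = cc"
    using assms by (intro AE_eventually_cc)
  show "AE \<omega> in M. (\<lambda>N. avg_payoff T R P S (\<lambda>n. Z n \<omega>) N) \<longlonglongrightarrow> (R, R)"
    using ev
  proof eventually_elim
    case (elim \<omega>)
    then obtain m where "\<And>n. n \<ge> m \<Longrightarrow> Z n \<omega> = cc" by blast
    then show ?case
      unfolding avg_payoff_def by (intro averages_of_eventually_constant[where m = m]) simp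
  qed
qed

end
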